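(* Let $n\geq 7$ and $m=\binom{n}{2}-k$ with $2\leq k\leq n/2$. Then there does not exist a least-optimal graph in $\mathcal{G}_{n,m}$.
   Context: All graphs are finite and simple. A set $S$ of vertices of a graph $G$ is dominating if every vertex of $G$ is in $S$ or adjacent to a vertex of $S$. The domination polynomial is $D(G,x)=\sum_{i=1}^{|V(G)|} d(G,i)x^i$, where $d(G,i)$ is the number of dominating sets of $G$ of cardinality $i$. $\mathcal{G}_{n,m}$ denotes the set of simple graphs with $n$ vertices and $m$ edges. A graph $H\in\mathcal{G}_{n,m}$ is least-optimal if $D(H,x)\leq D(G,x)$ for all $G\in\mathcal{G}_{n,m}$ and all $x\geq 0$. *)

theory Defs
  imports Complex_Main "HOL-Computational_Algebra.Polynomial"
begin

text \<open>A graph is a pair of a vertex set and a set of edges, each edge being a two-element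
  set of vertices (hence no loops and no multiple edges).\<close>

type_synonym 'a graph = "'a set \<times> 'a set set"

abbreviation verts :: "'a graph \<Rightarrow> 'a set" where
  "verts G \<equiv> fst G"

abbreviation edges :: "'a graph \<Rightarrow> 'a set set" where
  "edges G \<equiv> snd G"

definition simple_graph :: "'a graph \<Rightarrow> bool" where
  "simple_graph G \<longleftrightarrow>
     finite (verts G) \<and> (\<forall>e\<in>edges G. e \<subseteq> verts G \<and> card e = 2)"

definition adjacent :: "'a graph \<Rightarrow> 'a \<Rightarrow> 'a \<Rightarrow> bool" where
  "adjacent G u v \<longleftrightarrow> {u, v} \<in> edges G"

definition dominating :: "'a graph \<Rightarrow> 'a set \<Rightarrow> bool" where
  "dominating G S \<longleftrightarrow>
     S \<subseteq> verts G \<and> (\<forall>v\<in>verts G. v \<in> S \<or> (\<exists>u\<in>S. adjacent G v u))"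

definition dom_count :: "'a graph \<Rightarrow> nat \<Rightarrow> nat" where
  "dom_count G i = card {S. dominating G S \<and> card S = i}"

definition dom_poly :: "'a graph \<Rightarrow> real poly" where
  "dom_poly G = (\<Sum>i = 1..card (verts G). monom (real (dom_count G i)) i)"

text \<open>The vertices are drawn from the type \<open>'a\<close>. As soon as \<open>'a\<close> has at least \<open>n\<close> elements,
  every isomorphism type of a simple graph with \<open>n\<close> vertices and \<open>m\<close> edges is represented.\<close>

definition graphs_nm :: "nat \<Rightarrow> nat \<Rightarrow> 'a graph set" where
  "graphs_nm n m = {G. simple_graph G \<and> card (verts G) = n \<and> card (edges G) = m}"

definition least_optimal :: "nat \<Rightarrow> nat \<Rightarrow> 'a graph \<Rightarrow> bool" where
  "least_optimal n m H \<longleftrightarrow>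
     H \<in> graphs_nm n m \<and>
     (\<forall>G \<in> (graphs_nm n m :: 'a graph set). \<forall>x::real. x \<ge> 0 \<longrightarrow> poly (dom_poly H) x \<le> poly (dom_poly G) x)"

end

theory Submission
  imports Defs
begin

text \<open>Work with the complement \<open>F\<close>, a set of \<open>k\<close> pairs: a set of vertices fails to dominate iff it
  lies in a complement neighbourhood. Near \<open>0\<close> the polynomial is governed by the number of vertices
  not covered by \<open>F\<close>. If two pairs of \<open>F\<close> meet, then \<open>F\<close> covers fewer than \<open>2 k \<le> n\<close> vertices, and
  moving one end of one of these pairs to an uncovered vertex decreases this number. Hence the \<open>F\<close> of
  a least-optimal graph is a matching, so that all sets of at least two vertices dominate. Making two
  pairs of \<open>F\<close> meet then creates a non-dominating set of size two, which decreases the polynomial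
  for large arguments.\<close>

definition pairs :: "'a set \<Rightarrow> 'a set set" where
  "pairs V = {e. e \<subseteq> V \<and> card e = 2}"

text \<open>The missing pairs \<open>F\<close> are the parameter because, for fixed
  \<open>V\<close>, the number of edges depends only on \<open>card F\<close>; swapping one pair of
  \<open>F\<close> for a new one stays within the same class.\<close>

definition cograph :: "'a set \<Rightarrow> 'a set set \<Rightarrow> 'a graph" where
  "cograph V F = (V, pairs V - F)"

lemma finite_pairs: "finite V \<Longrightarrow> finite (pairs V)"
  by (simp add: pairs_def)

lemma card_pairs: "finite V \<Longrightarrow> card (pairs V) = card V choose 2"
  by (simp add: pairs_def n_subsets)

lemma doubleton_in_pairs: "{u, v} \<in> pairs V \<longleftrightarrow> u \<in> V \<and> v \<in> V \<and> u \<noteq> v"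
  by (auto simp: pairs_def card_2_iff doubleton_eq_iff)

lemma pairs_obtain_other:
  assumes "e \<in> pairs V" "u \<in> e"
  obtains v where "e = {u, v}" "u \<noteq> v" "v \<in> V"
  using assms by (auto simp: pairs_def card_2_iff)

lemma cograph_in_graphs_nm:
  assumes "finite V" "F \<subseteq> pairs V"
  shows "cograph V F \<in> graphs_nm (card V) ((card V choose 2) - card F)"
  using assms finite_pairs[OF assms(1)]
  by (auto simp: graphs_nm_def simple_graph_def cograph_def card_Diff_subset finite_subset card_pairs)
     (auto simp: pairs_def)

lemma simple_graph_eq_cograph:
  assumes "simple_graph G"
  shows "G = cograph (verts G) (pairs (verts G) - edges G)"
  using assms by (cases G) (auto simp: simple_graph_def cograph_def pairs_def)

text \<open>A vertex \<open>v\<close> is left undominated iff every \<open>u\<close> in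
  \<open>S\<close> is joined to it in the complement. That \<open>v\<close> itself lies outside
  \<open>S\<close> need not be demanded separately, since \<open>{v, v}\<close> is a singleton and
  so never in \<open>F\<close>.\<close>

lemma dominating_cograph_iff:
  assumes "F \<subseteq> pairs V" "S \<subseteq> V"
  shows "dominating (cograph V F) S \<longleftrightarrow> \<not> (\<exists>v\<in>V. \<forall>u\<in>S. {u, v} \<in> F)"
proof -
  have "v \<in> S \<or> (\<exists>u\<in>S. {v, u} \<in> pairs V - F) \<longleftrightarrow> \<not> (\<forall>u\<in>S. {u, v} \<in> F)" if "v \<in> V" for v
  proof (cases "v \<in> S")
    case True
    have "{v, v} \<notin> F" using assms(1) doubleton_in_pairs[of v v V] by blast
    with True show ?thesis by blast
  next
    case False
    then have "{v, u} \<in> pairs V" if "u \<in> S" for u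
      using that \<open>v \<in> V\<close> assms(2) by (auto simp: doubleton_in_pairs)
    with False show ?thesis by (auto simp: insert_commute)
  qed
  then show ?thesis using assms(2)
    by (auto simp: dominating_def adjacent_def cograph_def)
qed

lemma dom_count_le_binomial:
  assumes "finite (verts G)"
  shows "dom_count G i \<le> card (verts G) choose i"
proof -
  have "dom_count G i \<le> card {S. S \<subseteq> verts G \<and> card S = i}"
    unfolding dom_count_def using assms by (intro card_mono) (auto simp: dominating_def)
  then show ?thesis using assms by (simp add: n_subsets)
qed

lemma dom_count_less_binomial:
  assumes "finite (verts G)" "S \<subseteq> verts G" "card S = i" "\<not> dominating G S"
  shows "dom_count G i < card (verts G) choose i"
proof -
  have "{S. dominating G S \<and> card S = i} \<subset> {S. S \<subseteq> verts G \<and> card S = i}"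
    using assms(2-4) unfolding dominating_def by blast
  then have "dom_count G i < card {S. S \<subseteq> verts G \<and> card S = i}"
    unfolding dom_count_def using assms(1) by (intro psubset_card_mono) auto
  then show ?thesis using assms by (simp add: n_subsets)
qed

lemma dom_count_eq_binomial:
  assumes "finite (verts G)" "\<And>S. S \<subseteq> verts G \<Longrightarrow> card S = i \<Longrightarrow> dominating G S"
  shows "dom_count G i = card (verts G) choose i"
proof -
  have "{S. dominating G S \<and> card S = i} = {S. S \<subseteq> verts G \<and> card S = i}"
    using assms(2) by (auto simp: dominating_def)
  then show ?thesis using assms(1) by (simp add: dom_count_def n_subsets)
qed

text \<open>A single vertex dominates exactly when it has no neighbour in the complement, that is,
  when no pair of \<open>F\<close> contains it.\<close>

lemma dom_count_cograph_1:
  assumes "F \<subseteq> pairs V"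
  shows "dom_count (cograph V F) 1 = card (V - \<Union>F)"
proof -
  have single: "dominating (cograph V F) {u} \<longleftrightarrow> u \<notin> \<Union>F" if "u \<in> V" for u
  proof -
    have "(\<exists>v\<in>V. {u, v} \<in> F) \<longleftrightarrow> u \<in> \<Union>F"
      using assms by (auto elim: pairs_obtain_other)
    then show ?thesis using assms that by (simp add: dominating_cograph_iff)
  qed
  have "{S. dominating (cograph V F) S \<and> card S = 1} = (\<lambda>u. {u}) ` (V - \<Union>F)"
  proof (intro equalityI subsetI)
    fix S assume "S \<in> {S. dominating (cograph V F) S \<and> card S = 1}"
    then obtain u where "S = {u}" "dominating (cograph V F) {u}"
      by (auto simp: card_1_singleton_iff)
    moreover from this have "u \<in> V" by (simp add: dominating_def cograph_def)
    ultimately show "S \<in> (\<lambda>u. {u}) ` (V - \<Union>F)" using single by blast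
  qed (use single in auto)
  then show ?thesis by (simp add: dom_count_def card_image)
qed

lemma poly_dom_poly:
  "poly (dom_poly G) x = (\<Sum>i = 1..card (verts G). real (dom_count G i) * x ^ i)"
  by (simp add: dom_poly_def poly_sum poly_monom)

lemma coeff_dom_poly:
  "coeff (dom_poly G) i = (if i \<in> {1..card (verts G)} then real (dom_count G i) else 0)"
  by (simp add: dom_poly_def coeff_sum)

text \<open>Writing \<open>p\<close> as \<open>x\<close> times \<open>q\<close>, the factor
  \<open>q\<close> is nonnegative for positive \<open>x\<close>, hence by continuity also at
  \<open>0\<close>, where its value is the linear coefficient of \<open>p\<close>.\<close>

lemma linear_coeff_nonneg:
  fixes p :: "real poly"
  assumes "coeff p 0 = 0" "\<And>x. x \<ge> 0 \<Longrightarrow> poly p x \<ge> 0"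
  shows "coeff p 1 \<ge> 0"
proof -
  obtain q where p: "p = pCons 0 q"
    using assms(1) by (cases p) auto
  have "poly q x \<ge> 0" if "x > 0" for x
    using assms(2)[of x] that by (simp add: p zero_le_mult_iff)
  then have "eventually (\<lambda>x. poly q x \<ge> 0) (at_right 0)"
    by (auto simp: eventually_at_filter)
  moreover have "(poly q \<longlongrightarrow> poly q 0) (at_right 0)"
    by (intro tendsto_intros)
  ultimately have "poly q 0 \<ge> 0"
    by (intro tendsto_lowerbound) auto
  then show ?thesis by (simp add: p poly_0_coeff_0)
qed

text \<open>The two meeting pairs cover at most three vertices and each of the others adds at most
  two, so the union has at most \<open>3 + 2 * (card F - 2)\<close> elements.\<close>

lemma card_Union_pairs_less:
  assumes "finite V" "F \<subseteq> pairs V" "e \<in> F" "f \<in> F" "e \<noteq> f" "e \<inter> f \<noteq> {}"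
  shows "card (\<Union>F) < 2 * card F"
proof -
  have fin: "finite F" using assms finite_pairs finite_subset by blast
  have two: "card g = 2" "finite g" if "g \<in> F" for g
    using that assms(1,2) by (auto simp: pairs_def intro: finite_subset)
  have "card (\<Union>(F - {e, f})) \<le> (\<Sum>g\<in>F - {e, f}. card g)"
    using two by (intro card_Union_le_sum_card)
  also have "\<dots> = 2 * card (F - {e, f})" using two by simp
  finally have rest: "card (\<Union>(F - {e, f})) \<le> 2 * card (F - {e, f})" .
  have "card (e \<inter> f) > 0" using assms two by (simp add: card_gt_0_iff)
  then have ef: "card (e \<union> f) \<le> 3"
    using card_Un_Int[of e f] two assms by simp
  \<comment> \<open>Monotonicity of \<open>card\<close> ensures that the subtraction on natural
    numbers is not truncated.\<close>
  have "card F = card (F - {e, f}) + card {e, f}"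
    using fin assms card_mono[of F "{e, f}"] by (subst card_Diff_subset) auto
  then have cF: "card F = card (F - {e, f}) + 2" using assms by simp
  have "\<Union>F = (e \<union> f) \<union> \<Union>(F - {e, f})" using assms by auto
  then have "card (\<Union>F) \<le> card (e \<union> f) + card (\<Union>(F - {e, f}))"
    by (metis card_Un_le)
  with rest ef cF show ?thesis by simp
qed

lemma card_exchange:
  assumes "finite F" "e \<in> F" "f \<notin> F"
  shows "card (insert f (F - {e})) = card F"
  using assms by (metis card_Suc_Diff1 card_insert_disjoint finite_Diff insert_Diff insert_iff)

text \<open>The difference of the two polynomials is nonnegative for nonnegative arguments and has
  no constant term, because the defining sums start at \<open>1\<close>.\<close>

lemma least_optimal_dom_count_1_le:
  fixes G H :: "'a graph"
  assumes "least_optimal n m H" "G \<in> graphs_nm n m" "n \<ge> 1"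
  shows "dom_count H 1 \<le> dom_count G 1"
proof -
  have "coeff (dom_poly G - dom_poly H) 1 \<ge> 0"
    using assms by (intro linear_coeff_nonneg) (auto simp: least_optimal_def coeff_dom_poly)
  then show ?thesis using assms by (simp add: least_optimal_def graphs_nm_def coeff_dom_poly)
qed

text \<open>Replace \<open>e = {u, v}\<close> by \<open>{v, w}\<close>, with \<open>u\<close> shared
  by \<open>e\<close> and \<open>f\<close>, and \<open>w\<close> uncovered. Then \<open>u\<close>
  stays covered by \<open>f\<close>, \<open>v\<close> by the new pair, and \<open>w\<close> becomes
  covered.\<close>

lemma exchange_decreases_uncovered:
  assumes "finite V" "F \<subseteq> pairs V" "2 * card F \<le> card V"
    and "e \<in> F" "f \<in> F" "e \<noteq> f" "e \<inter> f \<noteq> {}"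
  obtains F' where "F' \<subseteq> pairs V" "card F' = card F" "card (V - \<Union>F') < card (V - \<Union>F)"
proof -
  have FV: "\<Union>F \<subseteq> V" using assms(2) by (auto simp: pairs_def)
  \<comment> \<open>The pairs cover strictly fewer than \<open>2 * card F \<le> card V\<close>
    vertices.\<close>
  have "\<Union>F \<noteq> V"
    using card_Union_pairs_less[of V F e f] assms by auto
  then obtain w where w: "w \<in> V" "w \<notin> \<Union>F" using FV by blast
  obtain u where u: "u \<in> e" "u \<in> f" using assms(7) by blast
  obtain v where v: "e = {u, v}" "u \<noteq> v" "v \<in> V"
    using pairs_obtain_other[of e V u] assms u by blast
  define F' where "F' = insert {v, w} (F - {e})"
  have "w \<noteq> v" using w v assms(4) by auto
  then have "F' \<subseteq> pairs V"
    using assms(2) w(1) v(3) by (auto simp: F'_def doubleton_in_pairs)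
  moreover have "{v, w} \<notin> F" using w by auto
  then have "card F' = card F"
    using assms finite_pairs finite_subset unfolding F'_def by (intro card_exchange) blast+
  moreover have "\<Union>F \<subseteq> \<Union>F'"
    using u v assms by (auto simp: F'_def)
  then have "V - \<Union>F' \<subset> V - \<Union>F"
    using w by (auto simp: F'_def)
  then have "card (V - \<Union>F') < card (V - \<Union>F)"
    using assms(1) by (intro psubset_card_mono) auto
  ultimately show thesis by (rule that)
qed

text \<open>From disjoint pairs \<open>{a, b}\<close> and \<open>{c, d}\<close>, replace the second
  by \<open>{a, c}\<close>. Now \<open>a\<close> has both \<open>b\<close> and \<open>c\<close> as
  complement neighbours, so \<open>{b, c}\<close> fails to dominate \<open>a\<close>.\<close>

lemma exchange_creates_nondominating_pair:
  assumes "finite V" "F \<subseteq> pairs V" "card F \<ge> 2" "pairwise disjnt F"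
  obtains F' S where "F' \<subseteq> pairs V" "card F' = card F" "S \<subseteq> V" "card S = 2"
    "\<not> dominating (cograph V F') S"
proof -
  have fin: "finite F" using assms finite_pairs finite_subset by blast
  obtain e f where ef: "e \<in> F" "f \<in> F" "e \<noteq> f"
    using assms(3) by (meson card_2_iff' obtain_subset_with_card_n subsetD)
  have disj: "e \<inter> f = {}" using assms(4) ef by (auto simp: pairwise_def disjnt_def)
  have "card e = 2" "card f = 2" using ef assms(2) by (auto simp: pairs_def)
  then obtain a b c d where ab: "e = {a, b}" "a \<noteq> b" and cd: "f = {c, d}" "c \<noteq> d"
    by (auto simp: card_2_iff)
  have V: "a \<in> V" "b \<in> V" "c \<in> V" using ef ab cd assms(2) by (auto simp: pairs_def)
  have ne: "a \<noteq> c" "b \<noteq> c" using disj ab cd by auto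
  define F' where "F' = insert {a, c} (F - {f})"
  have sub: "F' \<subseteq> pairs V"
    using assms(2) V ne by (auto simp: F'_def doubleton_in_pairs)
  \<comment> \<open>The added pair is new: it differs from \<open>e\<close> but shares
    \<open>a\<close> with it, which is impossible inside a matching.\<close>
  moreover have "{a, c} \<notin> F"
  proof
    assume "{a, c} \<in> F"
    moreover have "{a, c} \<noteq> e" using ab ne by auto
    ultimately have "{a, c} \<inter> e = {}" using assms(4) ef by (auto simp: pairwise_def disjnt_def)
    with ab show False by auto
  qed
  then have "card F' = card F"
    using fin ef unfolding F'_def by (intro card_exchange)
  moreover have "\<forall>u\<in>{b, c}. {u, a} \<in> F'"
    using ef ab by (auto simp: F'_def insert_commute)
  then have "\<not> dominating (cograph V F') {b, c}"
    using sub V by (subst dominating_cograph_iff) auto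
  ultimately show thesis using V ne by (intro that[of F' "{b, c}"]) auto
qed

text \<open>A vertex missed by two distinct elements of \<open>S\<close> would lie in two distinct
  pairs of \<open>F\<close>.\<close>

lemma matching_dominating:
  assumes "F \<subseteq> pairs V" "pairwise disjnt F" "S \<subseteq> V" "card S \<ge> 2"
  shows "dominating (cograph V F) S"
proof -
  have "\<not> (\<forall>u\<in>S. {u, v} \<in> F)" for v
  proof
    assume *: "\<forall>u\<in>S. {u, v} \<in> F"
    obtain a b where "a \<in> S" "b \<in> S" "a \<noteq> b"
      using assms(4) by (meson card_2_iff' obtain_subset_with_card_n subsetD)
    then have "{a, v} \<in> F" "{b, v} \<in> F" "{a, v} \<noteq> {b, v}"
      using * by (auto simp: doubleton_eq_iff)
    then have "{a, v} \<inter> {b, v} = {}" using assms(2) by (auto simp: pairwise_def disjnt_def)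
    then show False by auto
  qed
  then show ?thesis using assms by (simp add: dominating_cograph_iff)
qed

text \<open>From degree two on, the coefficients of \<open>H\<close> are the largest possible. At
  \<open>x = n + 1\<close> the deficit of \<open>G\<close> in degree two costs at least
  \<open>x ^ 2\<close>, while its linear term is at most \<open>n * x < x ^ 2\<close>.\<close>

lemma dom_poly_less_at_large:
  assumes "finite (verts G)" "card (verts G) = n" "card (verts H) = n" "n \<ge> 2"
    and "\<And>i. i \<ge> 2 \<Longrightarrow> dom_count H i = n choose i"
    and "dom_count G 2 < n choose 2"
  shows "poly (dom_poly G) (n + 1) < poly (dom_poly H) (n + 1)"
proof -
  define x where "x = real n + 1"
  have x: "x > 0" by (simp add: x_def)
  have split: "{Suc 0..n} = insert 1 (insert 2 {3..n})" using assms(4) by auto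
  have le: "dom_count G i \<le> n choose i" for i using dom_count_le_binomial assms by metis
  have rest: "(\<Sum>i = 3..n. real (dom_count G i) * x ^ i) \<le> (\<Sum>i = 3..n. real (dom_count H i) * x ^ i)"
    using le assms(5) x by (intro sum_mono mult_right_mono) auto
  have "real (dom_count G 2) + 1 \<le> real (dom_count H 2)"
    using assms(5)[of 2] assms(6) by linarith
  then have "(real (dom_count G 2) + 1) * x ^ 2 \<le> real (dom_count H 2) * x ^ 2"
    by (intro mult_right_mono) auto
  moreover have "real (dom_count G 1) * x < x ^ 2"
    using le[of 1] x by (simp add: power2_eq_square) (simp add: x_def)
  moreover have "0 \<le> real (dom_count H 1) * x" using x by simp
  ultimately have "poly (dom_poly G) x < poly (dom_poly H) x"
    using rest by (simp add: poly_dom_poly assms split algebra_simps)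
  then show ?thesis by (simp add: x_def add.commute)
qed

theorem theorem3p2:
  fixes n m k :: nat
  assumes "n \<ge> 7"
    and "m = (n choose 2) - k"
    and "2 \<le> k" and "real k \<le> real n / 2"
  shows "\<not> (\<exists>H :: 'a graph. least_optimal n m H)"
proof
  assume "\<exists>H :: 'a graph. least_optimal n m H"
  then obtain H :: "'a graph" where opt: "least_optimal n m H" by blast
  define V where "V = verts H"
  define F where "F = pairs V - edges H"
  have simple: "simple_graph H" and n: "card V = n" and m: "card (edges H) = m"
    using opt by (auto simp: least_optimal_def graphs_nm_def V_def)
  have fin: "finite V" using simple by (simp add: simple_graph_def V_def)
  have H: "H = cograph V F"
    unfolding V_def F_def by (rule simple_graph_eq_cograph[OF simple])
  have F: "F \<subseteq> pairs V" by (auto simp: F_def)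
  \<comment> \<open>The bound \<open>k \<le> n choose 2\<close> keeps the subtraction defining
    \<open>m\<close> from being truncated, so that \<open>F\<close> has exactly \<open>k\<close>
    pairs.\<close>
  have "2 * k \<le> n" using assms(4) by linarith
  moreover have "n \<le> n choose 2"
    using assms(1) by (simp add: choose_two less_eq_div_iff_mult_less_eq)
  ultimately have "k \<le> n choose 2" by linarith
  have "edges H \<subseteq> pairs V" using simple by (auto simp: simple_graph_def pairs_def V_def)
  then have cF: "card F = k"
    using \<open>k \<le> n choose 2\<close> fin n m assms(2) finite_subset[OF _ finite_pairs[OF fin]]
    by (simp add: F_def card_Diff_subset card_pairs)
  have mem: "cograph V F' \<in> graphs_nm n m" if "F' \<subseteq> pairs V" "card F' = card F" for F'
    using cograph_in_graphs_nm[OF fin that(1)] that cF n assms(2) by simp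
  have "pairwise disjnt F"
  proof (rule ccontr)
    assume "\<not> pairwise disjnt F"
    then obtain e f where "e \<in> F" "f \<in> F" "e \<noteq> f" "e \<inter> f \<noteq> {}"
      by (auto simp: pairwise_def disjnt_def)
    then obtain F' where F': "F' \<subseteq> pairs V" "card F' = card F" "card (V - \<Union>F') < card (V - \<Union>F)"
      using exchange_decreases_uncovered[OF fin F] \<open>2 * k \<le> n\<close> cF n by metis
    \<comment> \<open>The linear coefficients count the uncovered vertices, so this contradicts the
      choice of \<open>F'\<close>.\<close>
    have "dom_count H 1 \<le> dom_count (cograph V F') 1"
      using opt mem F' assms(1) by (intro least_optimal_dom_count_1_le) auto
    with F' F show False by (simp only: H dom_count_cograph_1)
  qed
  then obtain F' S where F': "F' \<subseteq> pairs V" "card F' = card F" and S: "S \<subseteq> V" "card S = 2"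
    and nd: "\<not> dominating (cograph V F') S"
    using exchange_creates_nondominating_pair[OF fin F] assms(3) cF by metis
  have verts [simp]: "verts (cograph V F'') = V" for F'' by (simp add: cograph_def)
  have "dom_count H i = n choose i" if "i \<ge> 2" for i
    using dom_count_eq_binomial[of H i] matching_dominating[OF F \<open>pairwise disjnt F\<close>] fin n that
    by (simp add: H)
  moreover have "dom_count (cograph V F') 2 < n choose 2"
    using dom_count_less_binomial[of "cograph V F'" S 2] fin n S nd by simp
  ultimately have "poly (dom_poly (cograph V F')) (n + 1) < poly (dom_poly H) (n + 1)"
    using fin n assms(1) by (intro dom_poly_less_at_large) (auto simp: H)
  moreover have "poly (dom_poly H) (n + 1) \<le> poly (dom_poly (cograph V F')) (n + 1)"
    using opt mem F' by (simp add: least_optimal_def)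
  ultimately show False by simp
qed

end
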